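(* Let $f:\mathbb{R}^d\to\mathbb{R}$ be differentiable (not necessarily convex) with a global minimizer $x_\star$, let $k:\mathbb{R}^d\to\mathbb{R}$ be differentiable and strictly convex with minimum $k(0)=0$, and let $\gamma\in(0,\infty)$. Assume there exist a norm $\|\cdot\|$ on $\mathbb{R}^d$, $b\in(1,\infty)$, $D_k,D_f\in(0,\infty)$, and a non-decreasing convex function $\sigma:[0,\infty)\to[0,\infty]$ with $\sigma(0)=0$ and $\sigma(ct)\le c^b\sigma(t)$ for all $c,t\in(0,\infty)$, such that $$\sigma(\|\nabla k(p)\|)\le D_kk(p)\quad\text{for all }p\in\mathbb{R}^d,$$ $$f(y)\le f(x)+\langle\nabla f(x),y-x\rangle+D_f\,\sigma(\|y-x\|)\quad\text{for all }x,y\in\mathbb{R}^d.$$ Let $\epsilon\in\big(0,(\gamma/(D_fD_k))^{1/(b-1)}\big]$, $\delta=(1+\gamma\epsilon)^{-1}$, $x_0,p_0\in\mathbb{R}^d$, and for $i\ge0$ $$p_{i+1}=\delta p_i-\epsilon\delta\nabla f(x_i),\qquad x_{i+1}=x_i+\epsilon\nabla k(p_{i+1}).$$ Then, with $\mathcal{H}_i=k(p_i)+f(x_i)-f(x_\star)$, for every $i\ge0$ $$\mathcal{H}_{i+1}-\mathcal{H}_i\le(\epsilon^bD_fD_k-\epsilon\gamma)\,k(p_{i+1})\le0,$$ and $\|\nabla f(x_i)\|_2\to0$ as $i\to\infty$.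
   Context: $\langle\cdot,\cdot\rangle$ is the standard inner product and $\|\cdot\|_2$ the Euclidean norm on $\mathbb{R}^d$. *)

theory Defs
  imports "HOL-Analysis.Analysis"
begin

text \<open>Meaningful only where \<open>f\<close> is differentiable; see \<open>GDERIV_grad\<close>.\<close>

definition grad :: "(real ^ 'd \<Rightarrow> real) \<Rightarrow> real ^ 'd \<Rightarrow> real ^ 'd" where
  "grad f x = (THE D. GDERIV f x :> D)"

lemma GDERIV_grad:
  fixes f :: "real ^ 'd \<Rightarrow> real"
  assumes "f differentiable (at x)"
  shows "GDERIV f x :> grad f x"
proof -
  obtain f' where f': "(f has_derivative f') (at x)"
    using assms by (auto simp: differentiable_def)
  then have lin: "linear f'"
    by (rule has_derivative_linear)
  have "f' = (\<lambda>h. h \<bullet> adjoint f' 1)"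
    using adjoint_works[OF lin, of _ 1] by (auto simp: fun_eq_iff)
  with f' have ex: "GDERIV f x :> adjoint f' 1"
    unfolding gderiv_def by simp
  moreover have "D = D'" if "GDERIV f x :> D" "GDERIV f x :> D'" for D D'
  proof -
    have "(\<lambda>h. h \<bullet> D) = (\<lambda>h. h \<bullet> D')"
      using that has_derivative_unique unfolding gderiv_def by blast
    then show ?thesis
      by (metis vector_eq_ldot)
  qed
  ultimately show ?thesis
    unfolding grad_def by (metis (mono_tags, lifting) theI)
qed

definition strictly_convex_on :: "'a::real_vector set \<Rightarrow> ('a \<Rightarrow> real) \<Rightarrow> bool" where
  "strictly_convex_on S f \<longleftrightarrow> convex S \<and>
    (\<forall>x\<in>S. \<forall>y\<in>S. \<forall>u>0. \<forall>v>0. x \<noteq> y \<longrightarrow> u + v = 1 \<longrightarrow>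
       f (u *\<^sub>R x + v *\<^sub>R y) < u * f x + v * f y)"

text \<open>
  The library notion \<open>convex_on\<close> covers only real-valued functions. The weights are taken
  positive here, so no product \<open>0 * \<infinity>\<close> arises; for weight 0 the inequality is trivial.
\<close>

definition ereal_convex_on :: "'a::real_vector set \<Rightarrow> ('a \<Rightarrow> ereal) \<Rightarrow> bool" where
  "ereal_convex_on S f \<longleftrightarrow> convex S \<and>
    (\<forall>x\<in>S. \<forall>y\<in>S. \<forall>u>0. \<forall>v>0. u + v = 1 \<longrightarrow>
       f (u *\<^sub>R x + v *\<^sub>R y) \<le> ereal u * f x + ereal v * f y)"

definition is_norm :: "('a::real_vector \<Rightarrow> real) \<Rightarrow> bool" where
  "is_norm N \<longleftrightarrow>
    (\<forall>x. 0 \<le> N x) \<and> (\<forall>x. N x = 0 \<longleftrightarrow> x = 0) \<and>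
    (\<forall>c x. N (c *\<^sub>R x) = \<bar>c\<bar> * N x) \<and> (\<forall>x y. N (x + y) \<le> N x + N y)"

end

theory Submission
  imports Defs
begin

text \<open>
  The energy estimate comes from evaluating the subgradient inequality for \<open>k\<close> at \<open>p (Suc i)\<close>
  once towards \<open>p i\<close> and once towards \<open>0\<close>. At the largest admissible step size the coefficient
  of \<open>k (p (Suc i))\<close> vanishes, so this estimate alone does not give \<open>p i \<longlonglongrightarrow> 0\<close>. Instead
  we keep the slack \<open>grad k q \<bullet> q - k q\<close> of the subgradient inequality towards \<open>0\<close>: it is
  dissipated in every step, hence tends to \<open>0\<close> along the iteration, and strict convexity bounds it
  away from \<open>0\<close> outside every ball around the origin. So \<open>p i \<longlonglongrightarrow> 0\<close>, and \<open>grad f (x i)\<close>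
  is a linear combination of \<open>p i\<close> and \<open>p (Suc i)\<close>.
\<close>

lemma strictly_convex_on_imp_convex_on:
  assumes "strictly_convex_on S f"
  shows "convex_on S f"
proof -
  have "f (u *\<^sub>R x + v *\<^sub>R y) \<le> u * f x + v * f y"
    if "x \<in> S" "y \<in> S" "0 \<le> u" "0 \<le> v" "u + v = 1" for x y u v
  proof (cases "x = y \<or> u = 0 \<or> v = 0")
    case True
    with that show ?thesis
      by (auto simp flip: scaleR_add_left distrib_right)
  next
    case False
    with that assms show ?thesis
      unfolding strictly_convex_on_def by (simp add: less_imp_le)
  qed
  with assms show ?thesis
    unfolding strictly_convex_on_def convex_on_def by auto
qed

text \<open>Restricted to the line through \<open>q\<close> and \<open>r\<close>, this becomes the
  tangent inequality for a convex function of one real variable, used at 0 and 1.\<close>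

lemma convex_on_above_tangent_grad:
  fixes k :: "real ^ 'd \<Rightarrow> real"
  assumes "convex_on UNIV k" and "k differentiable (at q)"
  shows "k q + grad k q \<bullet> (r - q) \<le> k r"
proof -
  define g where "g = (\<lambda>t. k (q + t *\<^sub>R (r - q)))"
  have "convex_on UNIV g"
  proof (rule convex_onI)
    fix t x y :: real
    assume t: "0 < t" "t < 1"
    have "q + ((1 - t) *\<^sub>R x + t *\<^sub>R y) *\<^sub>R (r - q)
        = (1 - t) *\<^sub>R (q + x *\<^sub>R (r - q)) + t *\<^sub>R (q + y *\<^sub>R (r - q))"
      by (simp add: algebra_simps)
    then show "g ((1 - t) *\<^sub>R x + t *\<^sub>R y) \<le> (1 - t) * g x + t * g y"
      unfolding g_def using convex_onD[OF assms(1), of t] t by simp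
  qed simp
  moreover have "(g has_field_derivative grad k q \<bullet> (r - q)) (at 0)"
  proof -
    have "(k has_derivative (\<lambda>h. h \<bullet> grad k q)) (at (q + 0 *\<^sub>R (r - q)))"
      using GDERIV_grad[OF assms(2)] unfolding gderiv_def by simp
    moreover have "((\<lambda>t. q + t *\<^sub>R (r - q)) has_derivative (\<lambda>t. t *\<^sub>R (r - q))) (at 0)"
      by (auto intro!: derivative_eq_intros)
    ultimately have "(g has_derivative (\<lambda>t. (t *\<^sub>R (r - q)) \<bullet> grad k q)) (at 0)"
      unfolding g_def by (rule has_derivative_compose[rotated])
    moreover have "(\<lambda>t. (t *\<^sub>R (r - q)) \<bullet> grad k q) = (*) (grad k q \<bullet> (r - q))"
      by (simp add: fun_eq_iff inner_commute)
    ultimately show ?thesis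
      by (simp add: has_field_derivative_def)
  qed
  ultimately have "grad k q \<bullet> (r - q) * (1 - 0) \<le> g 1 - g 0"
    by (intro convex_on_imp_above_tangent) auto
  then show ?thesis
    by (simp add: g_def)
qed

text \<open>
  The gap on the left is nondecreasing along rays from the origin. This reduces the claim to the
  compact sphere of radius \<open>r\<close>, where the gap is bounded below by the continuous positive function
  \<open>k u - 2 * k (u / 2)\<close>; no continuity of \<open>grad k\<close> is needed.
\<close>

lemma strictly_convex_tangent_gap_bound:
  fixes k :: "real ^ 'd \<Rightarrow> real"
  assumes sc: "strictly_convex_on UNIV k" and diff: "\<And>q. k differentiable (at q)"
    and zero: "k 0 = 0" and "0 < r"
  obtains c where "0 < c" "\<And>q. r \<le> norm q \<Longrightarrow> c \<le> grad k q \<bullet> q - k q"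
proof -
  note tangent = convex_on_above_tangent_grad[OF strictly_convex_on_imp_convex_on[OF sc] diff]
  define \<phi> where "\<phi> = (\<lambda>u. k u - 2 * k ((1/2) *\<^sub>R u))"
  have cont: "continuous_on UNIV k"
    by (simp add: continuous_on_eq_continuous_at differentiable_imp_continuous_within diff)
  have "continuous_on (sphere 0 r) \<phi>"
    unfolding \<phi>_def
    by (intro continuous_intros continuous_on_compose2[OF cont]) auto
  moreover have "sphere (0 :: real ^ 'd) r \<noteq> {}"
    using \<open>0 < r\<close> by (simp add: sphere_eq_empty)
  ultimately obtain m where m: "m \<in> sphere 0 r" "\<And>u. u \<in> sphere 0 r \<Longrightarrow> \<phi> m \<le> \<phi> u"
    using continuous_attains_inf[OF compact_sphere] by metis
  have "m \<noteq> 0"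
    using m(1) \<open>0 < r\<close> by auto
  \<comment> \<open>The midpoint of \<open>m\<close> and the origin: together with
    \<open>k 0 = 0\<close>, strict convexity gives the positive constant.\<close>
  then have "k ((1/2) *\<^sub>R m + (1/2) *\<^sub>R 0) < 1/2 * k m + 1/2 * k 0"
    using sc unfolding strictly_convex_on_def
    by (metis UNIV_I field_sum_of_halves half_gt_zero zero_less_one)
  then have "0 < \<phi> m"
    by (simp add: \<phi>_def zero)
  moreover have "\<phi> m \<le> grad k q \<bullet> q - k q" if q: "r \<le> norm q" for q
  proof -
    define s where "s = r / norm q"
    define u where "u = s *\<^sub>R q"
    have "0 < norm q"
      using q \<open>0 < r\<close> by linarith
    then have s: "0 < s" "s \<le> 1" and u: "u \<in> sphere 0 r"
      using q \<open>0 < r\<close> by (simp_all add: s_def u_def)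
    \<comment> \<open>Here \<open>u\<close> is the radial projection of \<open>q\<close> to the
      sphere. The three tangents are taken at \<open>q\<close> towards \<open>u\<close>, at
      \<open>u\<close> towards \<open>q\<close>, and at \<open>u\<close> towards its half.\<close>
    have 1: "k q - (1 - s) * (grad k q \<bullet> q) \<le> k u"
      using tangent[of q u] by (simp add: u_def algebra_simps)
    have 2: "k u + (1 - s) * (grad k u \<bullet> q) \<le> k q"
      using tangent[of u q] by (simp add: u_def algebra_simps)
    have 3: "k u - s / 2 * (grad k u \<bullet> q) \<le> k ((1/2) *\<^sub>R u)"
      using tangent[of u "(1/2) *\<^sub>R u"] by (simp add: u_def algebra_simps)
    \<comment> \<open>Adding the first two tangents and cancelling \<open>1 - s\<close> gives
      monotonicity of the gradient along the ray. If \<open>s = 1\<close>, then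
      \<open>u = q\<close>.\<close>
    have "grad k u \<bullet> q \<le> grad k q \<bullet> q"
    proof (cases "s = 1")
      case False
      have "(1 - s) * (grad k u \<bullet> q) \<le> (1 - s) * (grad k q \<bullet> q)"
        using 1 2 by linarith
      with False s show ?thesis
        by simp
    qed (simp add: u_def)
    then have "s * (grad k u \<bullet> q) \<le> s * (grad k q \<bullet> q)"
      using s by simp
    \<comment> \<open>By 3, \<open>\<phi> u\<close> is at most
      \<open>s * (grad k u \<bullet> q) - k u\<close>; monotonicity replaces \<open>grad k u\<close>
      by \<open>grad k q\<close>, and 1 replaces \<open>k u\<close> by a bound at
      \<open>q\<close>.\<close>
    with 1 3 have "\<phi> u \<le> grad k q \<bullet> q - k q"
      by (simp add: \<phi>_def algebra_simps)
    with m(2)[OF u] show ?thesis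
      by linarith
  qed
  ultimately show thesis
    using that by blast
qed

theorem lemma3p5:
  fixes f k :: "real ^ 'd \<Rightarrow> real"
    and N :: "real ^ 'd \<Rightarrow> real"
    and \<sigma> :: "real \<Rightarrow> ereal"
    and b D\<^sub>k D\<^sub>f \<gamma> \<epsilon> \<delta> :: real
    and x\<^sub>m :: "real ^ 'd"
    and x p :: "nat \<Rightarrow> real ^ 'd"
    and H :: "nat \<Rightarrow> real"
  assumes f_diff: "\<forall>z. f differentiable (at z)"
    and f_min: "\<forall>z. f x\<^sub>m \<le> f z"
    and k_diff: "\<forall>q. k differentiable (at q)"
    and k_convex: "strictly_convex_on UNIV k"
    and k_min: "k 0 = 0" "\<forall>q. k 0 \<le> k q"
    and gamma: "0 < \<gamma>"
    and norm_N: "is_norm N"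
    and b: "1 < b"
    and Dk: "0 < D\<^sub>k" and Df: "0 < D\<^sub>f"
    and sigma_nonneg: "\<forall>t\<ge>0. 0 \<le> \<sigma> t"
    and sigma_mono: "mono_on {0..} \<sigma>"
    and sigma_convex: "ereal_convex_on {0..} \<sigma>"
    and sigma_zero: "\<sigma> 0 = 0"
    and sigma_scale: "\<forall>c>0. \<forall>t>0. \<sigma> (c * t) \<le> ereal (c powr b) * \<sigma> t"
    and k_bound: "\<forall>q. \<sigma> (N (grad k q)) \<le> ereal (D\<^sub>k * k q)"
    and f_bound: "\<forall>y z. ereal (f y) \<le>
          ereal (f z + grad f z \<bullet> (y - z)) + ereal D\<^sub>f * \<sigma> (N (y - z))"
    and eps: "\<epsilon> \<in> {0 <.. (\<gamma> / (D\<^sub>f * D\<^sub>k)) powr (1 / (b - 1))}"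
    and delta: "\<delta> = 1 / (1 + \<gamma> * \<epsilon>)"
    and p_step: "\<forall>i. p (Suc i) = \<delta> *\<^sub>R p i - (\<epsilon> * \<delta>) *\<^sub>R grad f (x i)"
    and x_step: "\<forall>i. x (Suc i) = x i + \<epsilon> *\<^sub>R grad k (p (Suc i))"
    and H_def: "\<forall>i. H i = k (p i) + f (x i) - f x\<^sub>m"
  shows "(\<forall>i. H (Suc i) - H i \<le> (\<epsilon> powr b * D\<^sub>f * D\<^sub>k - \<epsilon> * \<gamma>) * k (p (Suc i)) \<and>
              (\<epsilon> powr b * D\<^sub>f * D\<^sub>k - \<epsilon> * \<gamma>) * k (p (Suc i)) \<le> 0) \<and>
         (\<lambda>i. norm (grad f (x i))) \<longlonglongrightarrow> 0"
proof -
  note tangent = convex_on_above_tangent_grad[OF strictly_convex_on_imp_convex_on[OF k_convex]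
      k_diff[rule_format]]
  define gap where "gap = (\<lambda>q. grad k q \<bullet> q - k q)"
  define C where "C = \<epsilon> powr b * D\<^sub>f * D\<^sub>k - \<epsilon> * \<gamma>"
  have "0 < \<epsilon>"
    using eps by simp
  then have "0 < 1 + \<gamma> * \<epsilon>"
    using gamma by (simp add: add_pos_pos)
  then have "0 < \<delta>" and delta_mult: "(1 + \<gamma> * \<epsilon>) * \<delta> = 1"
    by (simp_all add: delta)
  have k_nonneg: "0 \<le> k q" for q
    using k_min by metis
  have gap_nonneg: "0 \<le> gap q" for q
    using tangent[of q 0] by (simp add: gap_def k_min(1))
  \<comment> \<open>The bound on \<open>\<epsilon>\<close>, raised to the power
    \<open>b - 1\<close>, is exactly this inequality divided by \<open>\<epsilon>\<close>.\<close>
  have "C \<le> 0"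
  proof -
    have "\<epsilon> powr (b - 1) \<le> ((\<gamma> / (D\<^sub>f * D\<^sub>k)) powr (1 / (b - 1))) powr (b - 1)"
      using eps b by (intro powr_mono2) auto
    also have "\<dots> = \<gamma> / (D\<^sub>f * D\<^sub>k)"
      using b gamma Df Dk by (simp add: powr_powr)
    finally have "\<epsilon> powr (b - 1) * (D\<^sub>f * D\<^sub>k) \<le> \<gamma>"
      using Df Dk by (simp add: pos_le_divide_eq)
    then have "\<epsilon> * (\<epsilon> powr (b - 1) * (D\<^sub>f * D\<^sub>k)) \<le> \<epsilon> * \<gamma>"
      using \<open>0 < \<epsilon>\<close> by simp
    moreover have "\<epsilon> powr b = \<epsilon> * \<epsilon> powr (b - 1)"
      using \<open>0 < \<epsilon>\<close> by (simp add: powr_mult_base)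
    ultimately show ?thesis
      by (simp add: C_def mult.assoc)
  qed
  have sigma_step: "\<sigma> (N (\<epsilon> *\<^sub>R grad k q)) \<le> ereal (\<epsilon> powr b * D\<^sub>k * k q)" for q
  proof -
    have N: "N (\<epsilon> *\<^sub>R grad k q) = \<epsilon> * N (grad k q)" "0 \<le> N (grad k q)"
      using norm_N \<open>0 < \<epsilon>\<close> unfolding is_norm_def by simp_all
    \<comment> \<open>Scaling is assumed only for positive arguments; a vanishing gradient is
      covered by \<open>\<sigma> 0 = 0\<close>.\<close>
    have "\<sigma> (\<epsilon> * N (grad k q)) \<le> ereal (\<epsilon> powr b) * \<sigma> (N (grad k q))"
      using N(2) \<open>0 < \<epsilon>\<close> sigma_scale sigma_zero by (cases "N (grad k q) = 0") auto
    also have "\<dots> \<le> ereal (\<epsilon> powr b) * ereal (D\<^sub>k * k q)"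
      using k_bound by (intro ereal_mult_left_mono) auto
    finally show ?thesis
      by (simp add: N(1) mult.assoc)
  qed
  have descent: "H (Suc i) - H i \<le> C * k (p (Suc i)) - \<epsilon> * \<gamma> * gap (p (Suc i))" for i
  proof -
    define q where "q = p (Suc i)"
    have "ereal (f (x (Suc i))) \<le> ereal (f (x i) + grad f (x i) \<bullet> (\<epsilon> *\<^sub>R grad k q))
        + ereal D\<^sub>f * \<sigma> (N (\<epsilon> *\<^sub>R grad k q))"
      using f_bound[rule_format, of "x (Suc i)" "x i"] x_step by (simp add: q_def)
    also have "\<dots> \<le> ereal (f (x i) + grad f (x i) \<bullet> (\<epsilon> *\<^sub>R grad k q))
        + ereal D\<^sub>f * ereal (\<epsilon> powr b * D\<^sub>k * k q)"
      using Df by (intro add_left_mono ereal_mult_left_mono sigma_step) auto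
    finally have f_step: "f (x (Suc i)) \<le> f (x i) + \<epsilon> * (grad f (x i) \<bullet> grad k q)
        + D\<^sub>f * (\<epsilon> powr b * D\<^sub>k * k q)"
      by simp
    \<comment> \<open>Rewrites the momentum update in implicit form, so that the increment
      \<open>p i - q\<close> is expressed through the new momentum \<open>q\<close>.\<close>
    have "(1 + \<gamma> * \<epsilon>) *\<^sub>R q
        = ((1 + \<gamma> * \<epsilon>) * \<delta>) *\<^sub>R p i - (\<epsilon> * ((1 + \<gamma> * \<epsilon>) * \<delta>)) *\<^sub>R grad f (x i)"
      unfolding q_def p_step[rule_format, of i] by (simp add: scaleR_diff_right mult_ac)
    then have "p i - q = (\<gamma> * \<epsilon>) *\<^sub>R q + \<epsilon> *\<^sub>R grad f (x i)"
      unfolding delta_mult by (simp add: algebra_simps)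
    then have "k q + (\<gamma> * \<epsilon> * (grad k q \<bullet> q) + \<epsilon> * (grad k q \<bullet> grad f (x i))) \<le> k (p i)"
      using tangent[of q "p i"] by (simp add: inner_add_right)
    \<comment> \<open>The terms pairing \<open>grad k q\<close> with \<open>grad f (x i)\<close>
      cancel, and \<open>grad k q \<bullet> q\<close> splits into
      \<open>gap q + k q\<close>.\<close>
    with f_step show ?thesis
      by (simp add: H_def C_def gap_def q_def[symmetric] inner_commute algebra_simps)
  qed
  have C_k: "C * k q \<le> 0" for q
    using \<open>C \<le> 0\<close> k_nonneg by (simp add: mult_nonpos_nonneg)
  have energy: "H (Suc i) - H i \<le> C * k (p (Suc i))" for i
  proof -
    have "0 \<le> \<epsilon> * \<gamma> * gap (p (Suc i))"
      using \<open>0 < \<epsilon>\<close> gamma gap_nonneg by simp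
    with descent[of i] show ?thesis
      by linarith
  qed
  have "0 \<le> H i" for i
    using k_nonneg[of "p i"] f_min by (simp add: H_def add_increasing)
  moreover have "decseq H"
    using energy C_k by (intro decseq_SucI) (smt (verit))
  ultimately obtain L where L: "H \<longlonglongrightarrow> L"
    using decseq_convergent by metis
  then have "(\<lambda>i. H i - H (Suc i)) \<longlonglongrightarrow> L - L"
    by (intro tendsto_diff LIMSEQ_Suc)
  then have H_diff: "(\<lambda>i. H i - H (Suc i)) \<longlonglongrightarrow> 0"
    by simp
  have "(\<lambda>i. p (Suc i)) \<longlonglongrightarrow> 0"
  proof (rule tendstoI)
    fix r :: real
    assume "0 < r"
    then obtain c where c: "0 < c" "\<And>q. r \<le> norm q \<Longrightarrow> c \<le> gap q"
      using strictly_convex_tangent_gap_bound[OF k_convex k_diff[rule_format] k_min(1)]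
      unfolding gap_def by metis
    have "0 < \<epsilon> * \<gamma> * c"
      using \<open>0 < \<epsilon>\<close> gamma c(1) by simp
    with H_diff have "\<forall>\<^sub>F i in sequentially. H i - H (Suc i) < \<epsilon> * \<gamma> * c"
      by (rule order_tendstoD)
    then show "\<forall>\<^sub>F i in sequentially. dist (p (Suc i)) 0 < r"
    proof eventually_elim
      case (elim i)
      \<comment> \<open>The term with \<open>C\<close> is nonpositive, so the energy drop alone
        controls the gap, even when \<open>C = 0\<close>.\<close>
      have "\<epsilon> * \<gamma> * gap (p (Suc i)) < \<epsilon> * \<gamma> * c"
        using elim descent[of i] C_k[of "p (Suc i)"] by linarith
      then have "gap (p (Suc i)) < c"
        using \<open>0 < \<epsilon>\<close> gamma by simp
      with c(2)[of "p (Suc i)"] show ?case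
        by force
    qed
  qed
  moreover from this have "p \<longlonglongrightarrow> 0"
    by (rule LIMSEQ_imp_Suc)
  ultimately have "(\<lambda>i. (1 / (\<epsilon> * \<delta>)) *\<^sub>R (\<delta> *\<^sub>R p i - p (Suc i)))
      \<longlonglongrightarrow> (1 / (\<epsilon> * \<delta>)) *\<^sub>R (\<delta> *\<^sub>R 0 - 0)"
    by (intro tendsto_intros)
  \<comment> \<open>Solving the momentum update for the gradient makes convergence of
    \<open>x\<close> and continuity of \<open>grad f\<close> unnecessary.\<close>
  moreover have "(1 / (\<epsilon> * \<delta>)) *\<^sub>R (\<delta> *\<^sub>R p i - p (Suc i)) = grad f (x i)" for i
    using \<open>0 < \<epsilon>\<close> \<open>0 < \<delta>\<close> by (simp add: p_step)
  ultimately have "(\<lambda>i. grad f (x i)) \<longlonglongrightarrow> 0"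
    by simp
  then have "(\<lambda>i. norm (grad f (x i))) \<longlonglongrightarrow> 0"
    by (rule tendsto_norm_zero)
  with energy C_k show ?thesis
    unfolding C_def by blast
qed

end
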